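(* Let $N\ge 2$, let $f_1,\dots,f_N:\mathbb{R}\to\mathbb{R}$ (not necessarily convex) satisfy (A1) and let $\Pi\in\mathbb{R}^{N\times N}$ satisfy (A2). Put $\gamma_m:=\max_j\gamma_j$. Let $\alpha>0$ be a fixed step size, let $(\mathbf{x}_k)_{k\ge1}$ be the CDSGD iterates $\mathbf{x}_{k+1}=\Pi\mathbf{x}_k-\alpha\,\mathbf{g}(\mathbf{x}_k)$, and suppose (A3) holds with constants $\zeta_1,\zeta_2,Q,Q_V$ and $Q_m:=Q_V+\zeta_2^2$. Put $\hat\gamma:=\gamma_m+\alpha^{-1}(1-\lambda_N(\Pi))$ and let $V_{\inf}$ be a lower bound of $V$ on an open set containing the iterates $\{\mathbf{x}_k\}$. If $$0<\alpha\le\frac{\zeta_1-(1-\lambda_N(\Pi))Q_m}{\gamma_mQ_m},$$ then for every integer $m\ge1$, $$\begin{aligned}\mathbb{E}\Big[\sum_{k=1}^m\|\nabla V(\mathbf{x}_k)\|^2\Big]&\le\frac{\hat\gamma m\alpha Q}{\zeta_1}+\frac{2(V(\mathbf{x}_1)-V_{\inf})}{\zeta_1\alpha}\\&=\frac{(\gamma_m\alpha+1-\lambda_N(\Pi))mQ}{\zeta_1}+\frac{2(V(\mathbf{x}_1)-V_{\inf})}{\zeta_1\alpha}.\end{aligned}$$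
   Context: There are $N$ agents, the vertices of a connected undirected graph $\mathcal{G}=(\mathcal{V},\mathcal{E})$, $\mathcal{V}=\{1,\dots,N\}$. The parameter dimension is $d=1$, so $\mathbf{x}=(x^1,\dots,x^N)^T\in\mathbb{R}^N$, where $x^j$ is the parameter of agent $j$; $f_j$ is the local objective of agent $j$. A function $f$ is $\gamma$-smooth if $f(y)\le f(x)+\nabla f(x)^T(y-x)+\frac{\gamma}{2}\|y-x\|^2$ for all $x,y$; a $\gamma$-smooth function is understood to be differentiable with $\gamma$-Lipschitz gradient. $f$ is coercive if $f(x)\to\infty$ as $\|x\|\to\infty$. (A1) Each $f_j$ is $\gamma_j$-smooth, proper and coercive, and $L_j$-Lipschitz: $|f_j(y)-f_j(x)|\le L_j\|y-x\|$ for all $x,y$. (A2) $\Pi=(\pi_{jl})$ is a real symmetric $N\times N$ matrix (agent interaction matrix) such that: $\pi_{jl}=0$ if $j\neq l$ and $(j,l)\notin\mathcal{E}$; $\mathbf{1}^T\Pi=\mathbf{1}^T$ and $\Pi\mathbf{1}=\mathbf{1}$; $\mathrm{null}(I-\Pi)=\mathrm{span}\{\mathbf{1}\}$; $I\succeq\Pi\succ0$. $\Pi$ is doubly stochastic. Its eigenvalues are written $1=\lambda_1(\Pi)>\lambda_2(\Pi)\ge\dots\ge\lambda_N(\Pi)>0$. CDSGD: starting from a deterministic $\mathbf{x}_1\in\mathbb{R}^N$, $\mathbf{x}_{k+1}=\Pi\mathbf{x}_k-\alpha\,\mathbf{g}(\mathbf{x}_k)$, where $\mathbf{g}(\mathbf{x}_k)=(g_1(x_k^1),\dots,g_N(x_k^N))^T$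 and $g_j(x^j_k)$ is a (random) stochastic gradient of $f_j$ at $x_k^j$. The Lyapunov function is $$V(\mathbf{x}):=\sum_{j=1}^N f_j(x^j)+\frac1{2\alpha}\|\mathbf{x}\|^2_{I-\Pi},\qquad \|\mathbf{x}\|_{I-\Pi}^2:=\mathbf{x}^T(I-\Pi)\mathbf{x},$$ and $\nabla\mathcal{J}^i(\mathbf{x}_k):=\mathbf{g}(\mathbf{x}_k)+\alpha^{-1}(I-\Pi)\mathbf{x}_k$ (the stochastic Lyapunov gradient), so that $\mathbf{x}_{k+1}=\mathbf{x}_k-\alpha\nabla\mathcal{J}^i(\mathbf{x}_k)$. (A3) Write $\mathbb{E}_k$ for expectation over the sampling at step $k$, conditionally on the past up to $\mathbf{x}_k$. There are scalars $\zeta_2\ge\zeta_1>0$, $Q\ge0$, $Q_V\ge0$ such that for all $k$: $\nabla V(\mathbf{x}_k)^T\mathbb{E}_k[\nabla\mathcal{J}^i(\mathbf{x}_k)]\ge\zeta_1\|\nabla V(\mathbf{x}_k)\|^2$; $\|\mathbb{E}_k[\nabla\mathcal{J}^i(\mathbf{x}_k)]\|\le\zeta_2\|\nabla V(\mathbf{x}_k)\|$; and $\mathbb{E}_k[\|\nabla\mathcal{J}^i(\mathbf{x}_k)\|^2]-\|\mathbb{E}_k[\nabla\mathcal{J}^i(\mathbf{x}_k)]\|^2\le Q+Q_V\|\nabla V(\mathbf{x}_k)\|^2$. $\mathbb{E}$ without subscript is total expectation; all expectations used are assumed to exist. *)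

theory Defs
  imports "HOL-Probability.Probability"
begin

definition gradient :: "('a::real_inner \<Rightarrow> real) \<Rightarrow> 'a \<Rightarrow> 'a" where
  "gradient f x = (THE D. GDERIV f x :> D)"

definition gamma_smooth :: "real \<Rightarrow> ('a::real_inner \<Rightarrow> real) \<Rightarrow> bool" where
  "gamma_smooth \<gamma> f \<longleftrightarrow>
     (\<forall>x. \<exists>D. GDERIV f x :> D) \<and>
     \<gamma>-lipschitz_on UNIV (gradient f) \<and>
     (\<forall>x y. f y \<le> f x + gradient f x \<bullet> (y - x) + \<gamma> / 2 * (norm (y - x))\<^sup>2)"

text \<open>Objectives are real-valued, so they are automatically proper (never \<open>-\<infinity>\<close>, not identically
  \<open>\<infinity>\<close>).\<close>

definition coercive :: "('a::real_normed_vector \<Rightarrow> real) \<Rightarrow> bool" where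
  "coercive f \<longleftrightarrow> filterlim f at_top at_infinity"

definition connected_undirected_graph :: "('n \<times> 'n) set \<Rightarrow> bool" where
  "connected_undirected_graph E \<longleftrightarrow> sym E \<and> (\<forall>i j. (i, j) \<in> E\<^sup>*)"

definition pos_semidef :: "real^'n^'n \<Rightarrow> bool" where
  "pos_semidef A \<longleftrightarrow> transpose A = A \<and> (\<forall>x. 0 \<le> x \<bullet> (A *v x))"

definition pos_def :: "real^'n^'n \<Rightarrow> bool" where
  "pos_def A \<longleftrightarrow> transpose A = A \<and> (\<forall>x. x \<noteq> 0 \<longrightarrow> 0 < x \<bullet> (A *v x))"

definition doubly_stochastic :: "real^'n^'n \<Rightarrow> bool" where
  "doubly_stochastic A \<longleftrightarrow>
     (\<forall>i j. 0 \<le> A $ i $ j) \<and> (\<forall>i. (\<Sum>j\<in>UNIV. A $ i $ j) = 1) \<and> (\<forall>j. (\<Sum>i\<in>UNIV. A $ i $ j) = 1)"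

text \<open>Below, \<open>1 :: real^'n\<close> is the all-ones vector.\<close>

definition interaction_matrix :: "('n \<times> 'n) set \<Rightarrow> real^'n^'n \<Rightarrow> bool" where
  "interaction_matrix E P \<longleftrightarrow>
     transpose P = P \<and>
     (\<forall>j l. j \<noteq> l \<and> (j, l) \<notin> E \<longrightarrow> P $ j $ l = 0) \<and>
     1 v* P = 1 \<and> P *v 1 = 1 \<and>
     {x. (mat 1 - P) *v x = 0} = span {1} \<and>
     pos_semidef (mat 1 - P) \<and> pos_def P \<and>
     doubly_stochastic P"

definition eigenvalue :: "real^'n^'n \<Rightarrow> real \<Rightarrow> bool" where
  "eigenvalue A c \<longleftrightarrow> (\<exists>v. v \<noteq> 0 \<and> A *v v = c *\<^sub>R v)"

text \<open>The last element of the decreasing list \<open>\<lambda>\<^sub>1 \<ge> \<dots> \<ge> \<lambda>\<^sub>N\<close> of eigenvalues. It is meant for symmetric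
  \<open>A\<close>, for which all eigenvalues are real and their set is finite and nonempty.\<close>

definition smallest_eigenvalue :: "real^'n^'n \<Rightarrow> real" where
  "smallest_eigenvalue A = Min {c. eigenvalue A c}"

definition weighted_norm_sq :: "real^'n^'n \<Rightarrow> real^'n \<Rightarrow> real" where
  "weighted_norm_sq A x = x \<bullet> (A *v x)"

definition lyapunov :: "('n \<Rightarrow> real \<Rightarrow> real) \<Rightarrow> real^'n^'n \<Rightarrow> real \<Rightarrow> real^'n \<Rightarrow> real" where
  "lyapunov f P \<alpha> x = (\<Sum>j\<in>UNIV. f j (x $ j)) + 1 / (2 * \<alpha>) * weighted_norm_sq (mat 1 - P) x"

text \<open>A sampling scheme \<open>g\<close> gives, for step \<open>k\<close> and agent \<open>j\<close>, the random stochastic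
  gradient \<open>g k j y \<omega>\<close> of the \<open>j\<close>-th local objective at the point \<open>y\<close>; the dependence on \<open>k\<close> and
  \<open>\<omega>\<close> is the sampling done at step \<open>k\<close>.\<close>

type_synonym ('w, 'n) sampled_grad = "nat \<Rightarrow> 'n \<Rightarrow> real \<Rightarrow> 'w \<Rightarrow> real"

definition stoch_grad :: "('w, 'n) sampled_grad \<Rightarrow> nat \<Rightarrow> real^'n \<Rightarrow> 'w \<Rightarrow> real^'n" where
  "stoch_grad g k x \<omega> = (\<chi> j. g k j (x $ j) \<omega>)"

definition stoch_lyapunov_grad ::
  "('w, 'n) sampled_grad \<Rightarrow> real^'n^'n \<Rightarrow> real \<Rightarrow> nat \<Rightarrow> real^'n \<Rightarrow> 'w \<Rightarrow> real^'n" where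
  "stoch_lyapunov_grad g P \<alpha> k x \<omega> = stoch_grad g k x \<omega> + inverse \<alpha> *\<^sub>R ((mat 1 - P) *v x)"

definition cdsgd_iterates ::
  "'w measure \<Rightarrow> ('w, 'n) sampled_grad \<Rightarrow> real^'n^'n \<Rightarrow> real \<Rightarrow> real^'n \<Rightarrow> (nat \<Rightarrow> 'w \<Rightarrow> real^'n) \<Rightarrow> bool" where
  "cdsgd_iterates M g P \<alpha> x1 x \<longleftrightarrow>
     (\<forall>\<omega>\<in>space M. x 1 \<omega> = x1) \<and>
     (\<forall>k\<ge>1. \<forall>\<omega>\<in>space M. x (Suc k) \<omega> = P *v x k \<omega> - \<alpha> *\<^sub>R stoch_grad g k (x k \<omega>) \<omega>)"

text \<open>Conditional expectation of a random vector, taken componentwise.\<close>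

definition vec_cond_exp :: "'w measure \<Rightarrow> 'w measure \<Rightarrow> ('w \<Rightarrow> real^'n) \<Rightarrow> 'w \<Rightarrow> real^'n" where
  "vec_cond_exp M F X \<omega> = (\<chi> j. real_cond_exp M F (\<lambda>\<omega>. X \<omega> $ j) \<omega>)"

end

theory Submission
  imports Defs
begin

text \<open>The Lyapunov function \<open>V\<close> obeys a quadratic upper bound with constant \<open>\<gamma>_hat\<close>, because
  \<open>I - \<Pi>\<close> is bounded above by \<open>1 - \<lambda>\<^sub>N\<close> (Rayleigh quotient). Applied to a step
  \<open>x\<^sub>k\<^sub>+\<^sub>1 = x\<^sub>k - \<alpha> J\<^sub>k\<close> and combined with the moment bounds on \<open>J\<^sub>k\<close>, it shows that \<open>V\<close> drops in expectation
  by at least \<open>\<alpha> \<zeta>\<^sub>1 / 2\<close> times the squared gradient, up to the noise \<open>\<gamma>_hat \<alpha>\<^sup>2 Q / 2\<close>; the step size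
  condition says precisely that \<open>\<gamma>_hat \<alpha> Q\<^sub>m \<le> \<zeta>\<^sub>1\<close>. Telescoping gives the claim.\<close>

section \<open>Spectrum and Rayleigh quotient of a symmetric matrix\<close>

lemma symmetric_matrix_inner:
  fixes A :: "real^'n^'n"
  assumes "transpose A = A"
  shows "x \<bullet> (A *v y) = (A *v x) \<bullet> y"
  by (metis assms dot_lmul_matrix vector_transpose_matrix)

text \<open>Eigenvectors for distinct eigenvalues are orthogonal, so choosing one per eigenvalue
  gives an independent set, which is finite in finite dimension. Finiteness gives \<open>Min\<close>
  in \<open>smallest_eigenvalue\<close> its intended meaning.\<close>

lemma finite_eigenvalues_symmetric:
  fixes A :: "real^'n^'n"
  assumes sym: "transpose A = A"
  shows "finite {c. eigenvalue A c}"
proof -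
  have "\<exists>v. \<forall>c. eigenvalue A c \<longrightarrow> v c \<noteq> 0 \<and> A *v v c = c *\<^sub>R v c"
    unfolding eigenvalue_def by (intro choice) blast
  then obtain v where v: "\<And>c. eigenvalue A c \<Longrightarrow> v c \<noteq> 0 \<and> A *v v c = c *\<^sub>R v c"
    by blast
  have orth: "v c \<bullet> v d = 0" if "eigenvalue A c" "eigenvalue A d" "c \<noteq> d" for c d
  proof -
    have "d * (v c \<bullet> v d) = c * (v c \<bullet> v d)"
      using symmetric_matrix_inner[OF sym, of "v c" "v d"] v[OF that(1)] v[OF that(2)] by simp
    with that(3) show ?thesis by simp
  qed
  \<comment> \<open>A vector chosen for two different eigenvalues would be orthogonal to itself,
    hence zero.\<close>
  have inj: "inj_on v {c. eigenvalue A c}"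
    by (metis (mono_tags, lifting) inj_onI inner_eq_zero_iff mem_Collect_eq orth v)
  have "pairwise orthogonal (v ` {c. eigenvalue A c})"
    unfolding pairwise_def orthogonal_def using orth by fastforce
  moreover have "0 \<notin> v ` {c. eigenvalue A c}" using v by force
  ultimately have "finite (v ` {c. eigenvalue A c})"
    by (simp add: pairwise_orthogonal_independent independent_bound)
  with inj show ?thesis by (simp add: finite_image_iff)
qed

text \<open>If \<open>w = B *v u\<close> were nonzero, the form at \<open>u - t *\<^sub>R w\<close>
  would be \<open>t * (t * b - 2 * a)\<close> with \<open>a > 0\<close>, which is negative for small
  positive \<open>t\<close>.\<close>

lemma nonneg_quadratic_form_null:
  fixes B :: "real^'n^'n"
  assumes sym: "transpose B = B" and nonneg: "\<And>h. 0 \<le> h \<bullet> (B *v h)" and "u \<bullet> (B *v u) = 0"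
  shows "B *v u = 0"
proof (rule ccontr)
  define w where "w = B *v u"
  define a where "a = w \<bullet> w"
  define b where "b = w \<bullet> (B *v w)"
  \<comment> \<open>Any positive \<open>t\<close> with \<open>t * b \<le> a\<close> would do; the
    \<open>+ 1\<close> keeps the denominator positive when \<open>b = 0\<close>.\<close>
  define t where "t = a / (b + 1)"
  assume "B *v u \<noteq> 0"
  then have a: "0 < a" by (simp add: a_def w_def)
  have b: "0 \<le> b" using nonneg by (simp add: b_def)
  have t: "0 < t" using a b by (simp add: t_def)
  have "u \<bullet> (B *v w) = a"
    by (simp add: symmetric_matrix_inner[OF sym] a_def w_def)
  then have "(u - t *\<^sub>R w) \<bullet> (B *v (u - t *\<^sub>R w)) = t * (t * b - 2 * a)"
    using assms(3)
    by (simp add: matrix_vector_mult_diff_distrib matrix_vector_mult_scaleR inner_diff_left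
        inner_diff_right a_def b_def w_def[symmetric] algebra_simps)
  then have "2 * a \<le> t * b"
    using nonneg[of "u - t *\<^sub>R w"] t by (simp add: zero_le_mult_iff)
  moreover have "t * b \<le> a"
    using a b by (simp add: t_def field_simps)
  ultimately show False using a by simp
qed

lemma smallest_eigenvalue_le:
  fixes A :: "real^'n^'n"
  assumes "transpose A = A" and "eigenvalue A c"
  shows "smallest_eigenvalue A \<le> c"
  unfolding smallest_eigenvalue_def using assms by (simp add: finite_eigenvalues_symmetric)

text \<open>By compactness the form has a minimum \<open>c\<close> on the unit sphere, attained at
  some \<open>u\<close>. The form of \<open>A - c *\<^sub>R mat 1\<close> is then nonnegative and
  vanishes at \<open>u\<close>, so \<open>u\<close> is an eigenvector for \<open>c\<close>, and the
  smallest eigenvalue is at most \<open>c\<close>.\<close>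

lemma smallest_eigenvalue_quadratic_form:
  fixes A :: "real^'n^'n"
  assumes sym: "transpose A = A"
  shows "smallest_eigenvalue A * (norm x)\<^sup>2 \<le> x \<bullet> (A *v x)"
proof -
  have "continuous_on (sphere 0 1) (\<lambda>x. x \<bullet> (A *v x))"
    by (intro continuous_intros linear_continuous_on) auto
  then have "\<exists>u\<in>sphere 0 1. \<forall>y\<in>sphere 0 1. u \<bullet> (A *v u) \<le> y \<bullet> (A *v y)"
    by (intro continuous_attains_inf) auto
  then obtain u :: "real^'n" where u: "norm u = 1"
    and umin: "\<And>y. norm y = 1 \<Longrightarrow> u \<bullet> (A *v u) \<le> y \<bullet> (A *v y)"
    by auto
  define c where "c = u \<bullet> (A *v u)"
  have form: "c * (norm y)\<^sup>2 \<le> y \<bullet> (A *v y)" for y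
  proof (cases "y = 0")
    case False
    then have "c \<le> (inverse (norm y) *\<^sub>R y) \<bullet> (A *v (inverse (norm y) *\<^sub>R y))"
      unfolding c_def by (intro umin) simp
    then have "c \<le> y \<bullet> (A *v y) / (norm y)\<^sup>2"
      by (simp add: matrix_vector_mult_scaleR power2_eq_square field_simps)
    with False show ?thesis by (simp add: pos_le_divide_eq)
  qed simp
  define B where "B = A - c *\<^sub>R mat 1"
  have B: "B *v y = A *v y - c *\<^sub>R y" for y
    by (simp add: B_def matrix_vector_mult_diff_rdistrib scaleR_matrix_vector_assoc[symmetric])
  have "transpose B = B"
    using sym by (simp add: B_def transpose_def mat_def vec_eq_iff)
  moreover have "0 \<le> y \<bullet> (B *v y)" for y
    using form[of y] by (simp add: B inner_diff_right power2_norm_eq_inner)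
  moreover have "u \<bullet> (B *v u) = 0"
    using u by (simp add: B inner_diff_right c_def flip: power2_norm_eq_inner)
  ultimately have "B *v u = 0" by (rule nonneg_quadratic_form_null)
  then have "eigenvalue A c"
    unfolding eigenvalue_def using u by (intro exI[of _ u]) (auto simp: B)
  then have "smallest_eigenvalue A \<le> c"
    by (rule smallest_eigenvalue_le[OF sym])
  then show ?thesis
    using form[of x] by (meson mult_right_mono order_trans zero_le_power2)
qed

section \<open>Gradients and the quadratic upper bound for the Lyapunov function\<close>

lemma gradient_eqI:
  assumes "GDERIV f x :> D"
  shows "gradient f x = D"
  unfolding gradient_def
proof (rule the_equality)
  show "GDERIV f x :> D" by (rule assms)
  fix D' assume "GDERIV f x :> D'"
  with assms have "(\<lambda>h. h \<bullet> D') = (\<lambda>h. h \<bullet> D)"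
    unfolding gderiv_def by (rule has_derivative_unique[rotated])
  then have "\<forall>h. h \<bullet> D' = h \<bullet> D" by (intro allI) (rule fun_cong)
  then show "D' = D" by (rule vector_eq_ldot[THEN iffD1])
qed

lemma gamma_smooth_GDERIV:
  assumes "gamma_smooth c f"
  shows "GDERIV f x :> gradient f x"
proof -
  obtain D where D: "GDERIV f x :> D" using assms unfolding gamma_smooth_def by blast
  then have "gradient f x = D" by (rule gradient_eqI)
  with D show ?thesis by (simp only:)
qed

lemma gamma_smooth_nonneg:
  assumes "gamma_smooth c f"
  shows "0 \<le> c"
  using assms lipschitz_on_nonneg unfolding gamma_smooth_def by blast

lemma gamma_smooth_continuous_gradient:
  assumes "gamma_smooth c f"
  shows "continuous_on UNIV (gradient f)"
  using assms lipschitz_on_continuous_on unfolding gamma_smooth_def by blast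

lemma GDERIV_quadratic_form:
  fixes A :: "real^'n^'n"
  assumes sym: "transpose A = A"
  shows "GDERIV (\<lambda>y. y \<bullet> (A *v y)) x :> 2 *\<^sub>R (A *v x)"
proof -
  have "((\<lambda>y. y \<bullet> (A *v y)) has_derivative (\<lambda>h. x \<bullet> (A *v h) + h \<bullet> (A *v x))) (at x)"
    by (auto intro!: derivative_intros bounded_linear_imp_has_derivative)
  then show ?thesis
    unfolding gderiv_def by (simp add: symmetric_matrix_inner[OF sym, of x] inner_commute)
qed

text \<open>The factor 2 from the quadratic form cancels the 2 in \<open>1 / (2 * \<alpha>)\<close>.
  The result is \<open>stoch_lyapunov_grad\<close> with exact gradients in place of the sampled
  ones.\<close>

lemma lyapunov_GDERIV:
  fixes P :: "real^'n^'n"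
  assumes smooth: "\<And>j. gamma_smooth (\<gamma> j) (f j)"
    and sym: "transpose P = P"
  shows "GDERIV (lyapunov f P \<alpha>) x :>
    (\<chi> j. gradient (f j) (x $ j)) + inverse \<alpha> *\<^sub>R ((mat 1 - P) *v x)"
proof -
  have "transpose (mat 1 - P) = mat 1 - P"
    using sym by (simp add: transpose_def mat_def vec_eq_iff)
  note form = GDERIV_quadratic_form[OF this, of x]
  have f: "(f j has_derivative (\<lambda>h. h * gradient (f j) (x $ j))) (at (x $ j))" for j
    using gamma_smooth_GDERIV[OF smooth[of j], of "x $ j"] unfolding gderiv_def by simp
  have "((\<lambda>y. f j (y $ j)) has_derivative (\<lambda>h. h $ j * gradient (f j) (x $ j))) (at x)" for j
    by (rule has_derivative_compose[of "\<lambda>y. y $ j" "\<lambda>h. h $ j" x UNIV "f j"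
          "\<lambda>h. h * gradient (f j) (x $ j)"])
      (rule bounded_linear_imp_has_derivative[OF bounded_linear_vec_nth] f)+
  then have "((\<lambda>y. \<Sum>j\<in>UNIV. f j (y $ j)) has_derivative
      (\<lambda>h. \<Sum>j\<in>UNIV. h $ j * gradient (f j) (x $ j))) (at x)"
    by (rule has_derivative_sum)
  then have "GDERIV (\<lambda>y. \<Sum>j\<in>UNIV. f j (y $ j)) x :> (\<chi> j. gradient (f j) (x $ j))"
    unfolding gderiv_def by (simp add: inner_vec_def)
  from GDERIV_add[OF this GDERIV_mult[OF GDERIV_const[of "1 / (2 * \<alpha>)"] form]] show ?thesis
    unfolding lyapunov_def[abs_def] weighted_norm_sq_def
    by (rule GDERIV_subst) (simp add: inverse_eq_divide)
qed

lemma lyapunov_continuous: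
  fixes P :: "real^'n^'n"
  assumes "\<And>j. gamma_smooth (\<gamma> j) (f j)" and "transpose P = P"
  shows "continuous_on UNIV (lyapunov f P \<alpha>)"
  using has_derivative_continuous[OF lyapunov_GDERIV[of \<gamma> f, OF assms, unfolded gderiv_def]]
  by (simp add: continuous_on_eq_continuous_at)

text \<open>Continuity, inherited from the Lipschitz gradients of the \<open>f j\<close>, makes the
  Lyapunov gradient along the iterates measurable with respect to the past.\<close>

lemma lyapunov_gradient_continuous:
  fixes P :: "real^'n^'n"
  assumes smooth: "\<And>j. gamma_smooth (\<gamma> j) (f j)" and "transpose P = P"
  shows "continuous_on UNIV (gradient (lyapunov f P \<alpha>))"
proof -
  have "continuous_on UNIV (\<lambda>x :: real^'n. gradient (f j) (x $ j))" for j
    by (rule continuous_on_compose2[OF gamma_smooth_continuous_gradient[OF smooth[of j]]])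
      (auto intro: continuous_intros)
  then have "continuous_on UNIV
      (\<lambda>x. (\<chi> j. gradient (f j) (x $ j)) + inverse \<alpha> *\<^sub>R ((mat 1 - P) *v x))"
    by (intro continuous_on_add continuous_on_vec_lambda continuous_on_scaleR continuous_on_const)
      (auto intro: linear_continuous_on)
  moreover have "gradient (lyapunov f P \<alpha>) =
      (\<lambda>x. (\<chi> j. gradient (f j) (x $ j)) + inverse \<alpha> *\<^sub>R ((mat 1 - P) *v x))"
    by (intro ext gradient_eqI lyapunov_GDERIV[OF assms])
  ultimately show ?thesis by simp
qed

text \<open>The local objectives contribute their smoothness bounds, with each
  \<open>\<gamma> j\<close> raised to the maximum. The quadratic form is expanded exactly, and only
  its second-order term is estimated, by the Rayleigh bound.\<close>

lemma lyapunov_quadratic_bound: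
  fixes P :: "real^'n^'n"
  assumes smooth: "\<And>j. gamma_smooth (\<gamma> j) (f j)" and sym: "transpose P = P" and "0 < \<alpha>"
  shows "lyapunov f P \<alpha> (x + h) \<le> lyapunov f P \<alpha> x + gradient (lyapunov f P \<alpha>) x \<bullet> h
    + (Max (range \<gamma>) + inverse \<alpha> * (1 - smallest_eigenvalue P)) / 2 * (norm h)\<^sup>2"
proof -
  define A where "A = mat 1 - P"
  define r where "r = Max (range \<gamma>)"
  have symA: "transpose A = A"
    using sym by (simp add: A_def transpose_def mat_def vec_eq_iff)
  have "f j ((x + h) $ j) \<le> f j (x $ j) + gradient (f j) (x $ j) * h $ j + r / 2 * (h $ j)\<^sup>2" for j
  proof -
    have "f j (x $ j + h $ j) \<le> f j (x $ j) + gradient (f j) (x $ j) * (x $ j + h $ j - x $ j)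
        + \<gamma> j / 2 * (norm (x $ j + h $ j - x $ j))\<^sup>2"
      using smooth[of j] unfolding gamma_smooth_def inner_real_def by blast
    moreover have "\<gamma> j / 2 * (h $ j)\<^sup>2 \<le> r / 2 * (h $ j)\<^sup>2"
      unfolding r_def by (intro mult_right_mono divide_right_mono Max_ge) auto
    ultimately show ?thesis by simp
  qed
  then have "(\<Sum>j\<in>UNIV. f j ((x + h) $ j)) \<le>
      (\<Sum>j\<in>UNIV. f j (x $ j) + gradient (f j) (x $ j) * h $ j + r / 2 * (h $ j)\<^sup>2)"
    by (rule sum_mono)
  also have "\<dots> = (\<Sum>j\<in>UNIV. f j (x $ j)) + (\<chi> j. gradient (f j) (x $ j)) \<bullet> h + r / 2 * (norm h)\<^sup>2"
    unfolding power2_norm_eq_inner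
    by (simp add: sum.distrib sum_distrib_left inner_vec_def power2_eq_square)
  finally have sum_le: "(\<Sum>j\<in>UNIV. f j ((x + h) $ j)) \<le>
    (\<Sum>j\<in>UNIV. f j (x $ j)) + (\<chi> j. gradient (f j) (x $ j)) \<bullet> h + r / 2 * (norm h)\<^sup>2" .
  \<comment> \<open>The lower Rayleigh bound for \<open>P\<close> becomes an upper bound for
    \<open>mat 1 - P\<close>.\<close>
  have "h \<bullet> (A *v h) \<le> (1 - smallest_eigenvalue P) * (norm h)\<^sup>2"
    using smallest_eigenvalue_quadratic_form[OF sym, of h]
    by (simp add: A_def matrix_vector_mult_diff_rdistrib inner_diff_right power2_norm_eq_inner
        algebra_simps)
  moreover have "(x + h) \<bullet> (A *v (x + h)) = x \<bullet> (A *v x) + 2 * ((A *v x) \<bullet> h) + h \<bullet> (A *v h)"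
    by (simp add: matrix_vector_right_distrib inner_add_left inner_add_right
        symmetric_matrix_inner[OF symA, of x h] inner_commute)
  ultimately have "(x + h) \<bullet> (A *v (x + h))
      \<le> x \<bullet> (A *v x) + 2 * ((A *v x) \<bullet> h) + (1 - smallest_eigenvalue P) * (norm h)\<^sup>2"
    by simp
  from mult_left_mono[OF this, of "1 / (2 * \<alpha>)"] \<open>0 < \<alpha>\<close>
  have "1 / (2 * \<alpha>) * ((x + h) \<bullet> (A *v (x + h))) \<le> 1 / (2 * \<alpha>) * (x \<bullet> (A *v x))
      + inverse \<alpha> * ((A *v x) \<bullet> h) + inverse \<alpha> * (1 - smallest_eigenvalue P) / 2 * (norm h)\<^sup>2"
    by (simp add: distrib_left inverse_eq_divide mult.assoc)
  moreover have "gradient (lyapunov f P \<alpha>) x \<bullet> h =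
      (\<chi> j. gradient (f j) (x $ j)) \<bullet> h + inverse \<alpha> * ((A *v x) \<bullet> h)"
    unfolding gradient_eqI[OF lyapunov_GDERIV[OF smooth sym]] A_def
    by (simp add: inner_add_left)
  ultimately show ?thesis
    using sum_le unfolding lyapunov_def weighted_norm_sq_def A_def[symmetric] r_def[symmetric]
    by (simp add: algebra_simps add_divide_distrib diff_divide_distrib)
qed

section \<open>Square-integrable random vectors and conditional expectation\<close>

lemma integrable_inner_of_square_integrable:
  fixes X Y :: "'w \<Rightarrow> 'b::euclidean_space"
  assumes [measurable]: "X \<in> borel_measurable M" "Y \<in> borel_measurable M"
    and "integrable M (\<lambda>\<omega>. (norm (X \<omega>))\<^sup>2)" "integrable M (\<lambda>\<omega>. (norm (Y \<omega>))\<^sup>2)"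
  shows "integrable M (\<lambda>\<omega>. X \<omega> \<bullet> Y \<omega>)"
proof (rule Bochner_Integration.integrable_bound)
  show "integrable M (\<lambda>\<omega>. (norm (X \<omega>))\<^sup>2 + (norm (Y \<omega>))\<^sup>2)" using assms by simp
  have "norm (X \<omega> \<bullet> Y \<omega>) \<le> (norm (X \<omega>))\<^sup>2 + (norm (Y \<omega>))\<^sup>2" for \<omega>
  proof -
    have "2 * (norm (X \<omega>) * norm (Y \<omega>)) \<le> (norm (X \<omega>))\<^sup>2 + (norm (Y \<omega>))\<^sup>2"
      using sum_squares_bound[of "norm (X \<omega>)" "norm (Y \<omega>)"] by simp
    moreover have "0 \<le> norm (X \<omega>) * norm (Y \<omega>)" by simp
    ultimately show ?thesis using Cauchy_Schwarz_ineq2[of "X \<omega>" "Y \<omega>"] by simp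
  qed
  then show "AE \<omega> in M. norm (X \<omega> \<bullet> Y \<omega>) \<le> norm ((norm (X \<omega>))\<^sup>2 + (norm (Y \<omega>))\<^sup>2)"
    by simp
qed measurable

lemma borel_measurable_vec_nth:
  fixes X :: "'w \<Rightarrow> real^'n"
  assumes "X \<in> borel_measurable M"
  shows "(\<lambda>\<omega>. X \<omega> $ j) \<in> borel_measurable M"
  using borel_measurable_inner[OF assms borel_measurable_const[of "axis j 1"]]
  by (simp add: inner_axis)

text \<open>In each component the \<open>F\<close>-measurable factor is pulled into the conditional
  expectation, which preserves the integral. This carries conditional bounds on the mean of
  \<open>Y\<close> over to total expectations.\<close>

lemma (in sigma_finite_subalgebra) vec_cond_exp_inner:
  fixes X Y :: "'a \<Rightarrow> real^'n"
  assumes X: "X \<in> borel_measurable F" and Y: "Y \<in> borel_measurable M"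
    and X2: "integrable M (\<lambda>\<omega>. (norm (X \<omega>))\<^sup>2)" and Y2: "integrable M (\<lambda>\<omega>. (norm (Y \<omega>))\<^sup>2)"
  shows "integrable M (\<lambda>\<omega>. X \<omega> \<bullet> vec_cond_exp M F Y \<omega>)"
    and "(\<integral>\<omega>. X \<omega> \<bullet> vec_cond_exp M F Y \<omega> \<partial>M) = (\<integral>\<omega>. X \<omega> \<bullet> Y \<omega> \<partial>M)"
proof -
  have XM: "X \<in> borel_measurable M" by (rule measurable_from_subalg[OF subalg X])
  have sq: "integrable M (\<lambda>\<omega>. (norm (Z \<omega> $ j))\<^sup>2)"
    if Z: "Z \<in> borel_measurable M" "integrable M (\<lambda>\<omega>. (norm (Z \<omega>))\<^sup>2)" for Z :: "'a \<Rightarrow> real^'n" and j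
  proof (rule Bochner_Integration.integrable_bound[OF Z(2)])
    show "(\<lambda>\<omega>. (norm (Z \<omega> $ j))\<^sup>2) \<in> borel_measurable M"
      using borel_measurable_vec_nth[OF Z(1), of j] by measurable
    have "(norm (Z \<omega> $ j))\<^sup>2 \<le> (norm (Z \<omega>))\<^sup>2" for \<omega>
      by (intro power_mono Finite_Cartesian_Product.norm_nth_le) simp
    then show "AE \<omega> in M. norm ((norm (Z \<omega> $ j))\<^sup>2) \<le> norm ((norm (Z \<omega>))\<^sup>2)" by simp
  qed
  have int: "integrable M (\<lambda>\<omega>. X \<omega> $ j * Y \<omega> $ j)" for j
    using integrable_inner_of_square_integrable[OF borel_measurable_vec_nth[OF XM, of j]
        borel_measurable_vec_nth[OF Y, of j] sq[OF XM X2] sq[OF Y Y2]] by simp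
  note comp = real_cond_exp_intg[OF int borel_measurable_vec_nth[OF X] borel_measurable_vec_nth[OF Y]]
  show "integrable M (\<lambda>\<omega>. X \<omega> \<bullet> vec_cond_exp M F Y \<omega>)"
    using comp(1) by (simp add: inner_vec_def vec_cond_exp_def)
  show "(\<integral>\<omega>. X \<omega> \<bullet> vec_cond_exp M F Y \<omega> \<partial>M) = (\<integral>\<omega>. X \<omega> \<bullet> Y \<omega> \<partial>M)"
    using comp int by (simp add: inner_vec_def vec_cond_exp_def)
qed

text \<open>Expectation over the sampling at step \<open>k\<close>, given the past, is encoded as
  conditional expectation with respect to \<open>F k\<close>, where \<open>F\<close> is a filtration
  and \<open>x k\<close> is \<open>F k\<close>-measurable. The moment conditions accordingly hold
  almost surely.\<close>

theorem theorem2: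
  fixes E :: "('n::finite \<times> 'n) set"
    and f :: "'n \<Rightarrow> real \<Rightarrow> real"
    and \<gamma> L :: "'n \<Rightarrow> real"
    and P :: "real^'n^'n"
    and M :: "'w measure"
    and F :: "nat \<Rightarrow> 'w measure"
    and g :: "('w, 'n) sampled_grad"
    and x1 :: "real^'n"
    and x :: "nat \<Rightarrow> 'w \<Rightarrow> real^'n"
    and S :: "(real^'n) set"
    and \<alpha> \<zeta>\<^sub>1 \<zeta>\<^sub>2 Q Q\<^sub>V V_inf \<gamma>\<^sub>m lambda_N Q\<^sub>m \<gamma>_hat :: real
    and V :: "real^'n \<Rightarrow> real"
    and J :: "nat \<Rightarrow> 'w \<Rightarrow> real^'n"
    and m :: nat
  assumes "\<gamma>\<^sub>m = Max (range \<gamma>)"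
    and "lambda_N = smallest_eigenvalue P"
    and "Q\<^sub>m = Q\<^sub>V + \<zeta>\<^sub>2\<^sup>2"
    and "\<gamma>_hat = \<gamma>\<^sub>m + inverse \<alpha> * (1 - lambda_N)"
    and "V = lyapunov f P \<alpha>"
    and "J = (\<lambda>k \<omega>. stoch_lyapunov_grad g P \<alpha> k (x k \<omega>) \<omega>)"
    and "CARD('n) \<ge> 2"
    and "connected_undirected_graph E"
    and "\<And>j. gamma_smooth (\<gamma> j) (f j)"
    and "\<And>j. coercive (f j)"
    and "\<And>j. (L j)-lipschitz_on UNIV (f j)"
    and "interaction_matrix E P"
    and "prob_space M"
    and "filtration (space M) F"
    and "\<And>k. subalgebra M (F k)"
    and "cdsgd_iterates M g P \<alpha> x1 x"
    and "\<And>k. k \<ge> 1 \<Longrightarrow> x k \<in> borel_measurable (F k)"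
    and "\<And>k. k \<ge> 1 \<Longrightarrow> integrable M (J k)"
    and "\<And>k. k \<ge> 1 \<Longrightarrow> integrable M (\<lambda>\<omega>. (norm (J k \<omega>))\<^sup>2)"
    and "\<And>k. k \<ge> 1 \<Longrightarrow> integrable M (\<lambda>\<omega>. (norm (gradient V (x k \<omega>)))\<^sup>2)"
    and "0 < \<zeta>\<^sub>1" and "\<zeta>\<^sub>1 \<le> \<zeta>\<^sub>2" and "0 \<le> Q" and "0 \<le> Q\<^sub>V"
    and "\<And>k. k \<ge> 1 \<Longrightarrow> AE \<omega> in M.
           gradient V (x k \<omega>) \<bullet> vec_cond_exp M (F k) (J k) \<omega>
             \<ge> \<zeta>\<^sub>1 * (norm (gradient V (x k \<omega>)))\<^sup>2"
    and "\<And>k. k \<ge> 1 \<Longrightarrow> AE \<omega> in M.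
           norm (vec_cond_exp M (F k) (J k) \<omega>) \<le> \<zeta>\<^sub>2 * norm (gradient V (x k \<omega>))"
    and "\<And>k. k \<ge> 1 \<Longrightarrow> AE \<omega> in M.
           real_cond_exp M (F k) (\<lambda>\<omega>. (norm (J k \<omega>))\<^sup>2) \<omega> - (norm (vec_cond_exp M (F k) (J k) \<omega>))\<^sup>2
             \<le> Q + Q\<^sub>V * (norm (gradient V (x k \<omega>)))\<^sup>2"
    and "open S"
    and "AE \<omega> in M. \<forall>k\<ge>1. x k \<omega> \<in> S"
    and "\<And>y. y \<in> S \<Longrightarrow> V_inf \<le> V y"
    and "0 < \<alpha>"
    and "\<alpha> \<le> (\<zeta>\<^sub>1 - (1 - lambda_N) * Q\<^sub>m) / (\<gamma>\<^sub>m * Q\<^sub>m)"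
    and "m \<ge> 1"
  shows "(\<integral>\<omega>. (\<Sum>k=1..m. (norm (gradient V (x k \<omega>)))\<^sup>2) \<partial>M)
           \<le> \<gamma>_hat * real m * \<alpha> * Q / \<zeta>\<^sub>1 + 2 * (V x1 - V_inf) / (\<zeta>\<^sub>1 * \<alpha>) \<and>
         \<gamma>_hat * real m * \<alpha> * Q / \<zeta>\<^sub>1 + 2 * (V x1 - V_inf) / (\<zeta>\<^sub>1 * \<alpha>)
           = (\<gamma>\<^sub>m * \<alpha> + 1 - lambda_N) * real m * Q / \<zeta>\<^sub>1 + 2 * (V x1 - V_inf) / (\<zeta>\<^sub>1 * \<alpha>)"
proof -

  \<comment> \<open>Signs of the constants and the step size condition\<close>
  note gam = assms(1) and lam = assms(2) and Qm = assms(3) and ghat = assms(4) and V = assms(5)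
    and J = assms(6) and smooth = assms(9) and interaction = assms(12) and sub = assms(15)
    and iter = assms(16) and xF = assms(17) and J_int = assms(18) and J2 = assms(19)
    and G2 = assms(20) and \<zeta>1 = assms(21) and \<zeta>12 = assms(22) and Q = assms(23) and QV = assms(24)
    and first = assms(25) and second = assms(26) and variance = assms(27) and inS = assms(29)
    and Vinf = assms(30) and \<alpha> = assms(31) and step = assms(32)
  interpret prob_space M by (rule assms(13))
  have subalgM: "sigma_finite_subalgebra M (F k)" for k
    by (intro finite_measure_subalgebra_is_sigma_finite finite_measure_subalgebra.intro
        finite_measure_subalgebra_axioms.intro sub finite_measure_axioms)
  have sym: "transpose P = P" and one: "P *v 1 = 1"
    using interaction unfolding interaction_matrix_def by auto
  define G where "G = (\<lambda>k \<omega>. gradient V (x k \<omega>))"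
  define R where "R = (\<lambda>k \<omega>. (norm (J k \<omega>))\<^sup>2)"
  have \<gamma>m: "0 \<le> \<gamma>\<^sub>m"
    using gamma_smooth_nonneg[OF smooth] unfolding gam by (subst Max_ge_iff) auto
  have Qm_pos: "0 < Q\<^sub>m"
    using \<zeta>1 \<zeta>12 QV by (simp add: Qm add_nonneg_pos)
  \<comment> \<open>If \<open>\<gamma>\<^sub>m = 0\<close>, the step size bound would read \<open>\<alpha> \<le> 0\<close>, as \<open>x / 0 = 0\<close>.\<close>
  have "\<gamma>\<^sub>m \<noteq> 0" using step \<alpha> by auto
  with \<gamma>m have \<gamma>m_pos: "0 < \<gamma>\<^sub>m" by simp
  \<comment> \<open>The all-ones vector is an eigenvector, so \<open>lambda_N \<le> 1\<close>. This
    gives \<open>0 \<le> \<gamma>_hat\<close>, so that upper bounds may later be multiplied by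
    \<open>\<gamma>_hat\<close>.\<close>
  have "eigenvalue P 1"
    unfolding eigenvalue_def using one by (intro exI[of _ 1]) (auto simp: vec_eq_iff)
  then have lam_le: "lambda_N \<le> 1"
    unfolding lam by (rule smallest_eigenvalue_le[OF sym])
  have ghat_nonneg: "0 \<le> \<gamma>_hat"
    using \<gamma>m lam_le \<alpha> by (simp add: ghat)
  have ghat_\<alpha>: "\<gamma>_hat * \<alpha> = \<gamma>\<^sub>m * \<alpha> + 1 - lambda_N"
    using \<alpha> by (simp add: ghat field_simps)
  have "\<alpha> * (\<gamma>\<^sub>m * Q\<^sub>m) \<le> \<zeta>\<^sub>1 - (1 - lambda_N) * Q\<^sub>m"
    using step \<gamma>m_pos Qm_pos by (simp add: pos_le_divide_eq)
  \<comment> \<open>In this form the condition limits the second-order term to half of the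
    first-order decrease.\<close>
  then have step': "\<gamma>_hat * \<alpha> * Q\<^sub>m \<le> \<zeta>\<^sub>1"
    unfolding ghat_\<alpha> by (simp add: algebra_simps)

  \<comment> \<open>Measurability, pathwise descent and integrability\<close>
  have V_cont: "continuous_on UNIV V" and G_cont: "continuous_on UNIV (gradient V)"
    unfolding V by (rule lyapunov_continuous[OF smooth sym] lyapunov_gradient_continuous[OF smooth sym])+
  have xM: "x k \<in> borel_measurable M" if "1 \<le> k" for k
    by (rule measurable_from_subalg[OF sub xF[OF that]])
  have VM: "(\<lambda>\<omega>. V (x k \<omega>)) \<in> borel_measurable M" if "1 \<le> k" for k
    by (rule borel_measurable_continuous_on[OF V_cont xM[OF that]])
  have GF: "G k \<in> borel_measurable (F k)" if "1 \<le> k" for k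
    unfolding G_def by (rule borel_measurable_continuous_on[OF G_cont xF[OF that]])
  have JM: "J k \<in> borel_measurable M" if "1 \<le> k" for k
    using J_int[OF that] by simp
  have G2': "integrable M (\<lambda>\<omega>. (norm (G k \<omega>))\<^sup>2)" if "1 \<le> k" for k
    using G2[OF that] by (simp add: G_def)
  have R_int: "integrable M (R k)" if "1 \<le> k" for k
    using J2[OF that] by (simp add: R_def)
  have GJ: "integrable M (\<lambda>\<omega>. G k \<omega> \<bullet> J k \<omega>)" if "1 \<le> k" for k
    by (intro integrable_inner_of_square_integrable measurable_from_subalg[OF sub GF] JM G2' J2 that)

  have descent: "V (x (Suc k) \<omega>) \<le> V (x k \<omega>) - \<alpha> * (G k \<omega> \<bullet> J k \<omega>) + \<gamma>_hat * \<alpha>\<^sup>2 / 2 * R k \<omega>"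
    if "1 \<le> k" "\<omega> \<in> space M" for k \<omega>
  proof -
    have "x (Suc k) \<omega> = P *v x k \<omega> - \<alpha> *\<^sub>R stoch_grad g k (x k \<omega>) \<omega>"
      using iter that unfolding cdsgd_iterates_def by blast
    \<comment> \<open>As \<open>\<alpha>\<close> is nonzero, it cancels the
      \<open>inverse \<alpha>\<close> in \<open>J\<close>: the update is a plain gradient step along
      \<open>J k\<close>.\<close>
    also have "\<dots> = x k \<omega> + (- \<alpha>) *\<^sub>R J k \<omega>"
      using \<alpha> by (simp add: J stoch_lyapunov_grad_def matrix_vector_mult_diff_rdistrib algebra_simps)
    finally show ?thesis
      using lyapunov_quadratic_bound[of \<gamma> f P \<alpha> "x k \<omega>" "(- \<alpha>) *\<^sub>R J k \<omega>", OF smooth sym \<alpha>]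
      by (simp add: V G_def R_def ghat gam lam power_mult_distrib mult.assoc)
  qed

  \<comment> \<open>Integrability propagates from the constant \<open>V x1\<close>: almost surely
    the next value lies between \<open>V_inf\<close> and the right-hand side of
    \<open>descent\<close>, which is integrable by induction.\<close>
  have V_int: "integrable M (\<lambda>\<omega>. V (x k \<omega>))" if "1 \<le> k" for k
    using that
  proof (induction k rule: dec_induct)
    case base
    have "integrable M (\<lambda>\<omega>. V x1)" by simp
    moreover have "V (x 1 \<omega>) = V x1" if "\<omega> \<in> space M" for \<omega>
      using iter that unfolding cdsgd_iterates_def by simp
    ultimately show ?case by (simp cong: Bochner_Integration.integrable_cong)
  next
    case (step k)
    let ?U = "\<lambda>\<omega>. V (x k \<omega>) - \<alpha> * (G k \<omega> \<bullet> J k \<omega>) + \<gamma>_hat * \<alpha>\<^sup>2 / 2 * R k \<omega>"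
    show ?case
    proof (rule Bochner_Integration.integrable_bound)
      show "integrable M (\<lambda>\<omega>. \<bar>?U \<omega>\<bar> + \<bar>V_inf\<bar>)"
        using step GJ[of k] R_int[of k] by simp
      show "AE \<omega> in M. norm (V (x (Suc k) \<omega>)) \<le> norm (\<bar>?U \<omega>\<bar> + \<bar>V_inf\<bar>)"
        using inS
      proof (rule AE_mp, intro AE_I2 impI)
        fix \<omega> assume "\<omega> \<in> space M" and S: "\<forall>k\<ge>1. x k \<omega> \<in> S"
        have "V_inf \<le> V (x (Suc k) \<omega>)" using S by (intro Vinf) simp
        with descent[OF step(1) \<open>\<omega> \<in> space M\<close>]
        show "norm (V (x (Suc k) \<omega>)) \<le> norm (\<bar>?U \<omega>\<bar> + \<bar>V_inf\<bar>)" by simp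
      qed
    qed (rule VM, simp)
  qed

  \<comment> \<open>Moment bounds and expected descent\<close>
  \<comment> \<open>\<open>G k\<close> is \<open>F k\<close>-measurable, so \<open>J k\<close> may
    be replaced by its conditional mean under the integral, where the first moment condition
    applies.\<close>
  have inner_ge: "\<zeta>\<^sub>1 * (\<integral>\<omega>. (norm (G k \<omega>))\<^sup>2 \<partial>M) \<le> (\<integral>\<omega>. G k \<omega> \<bullet> J k \<omega> \<partial>M)" if k: "1 \<le> k" for k
  proof -
    note ce = sigma_finite_subalgebra.vec_cond_exp_inner[OF subalgM GF[OF k] JM[OF k] G2'[OF k] J2[OF k]]
    have "(\<integral>\<omega>. \<zeta>\<^sub>1 * (norm (G k \<omega>))\<^sup>2 \<partial>M) \<le> (\<integral>\<omega>. G k \<omega> \<bullet> vec_cond_exp M (F k) (J k) \<omega> \<partial>M)"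
      using first[OF k] G2'[OF k] ce(1) by (intro integral_mono_AE) (auto simp: G_def)
    then show ?thesis by (simp add: ce(2))
  qed
  \<comment> \<open>The conditional second moment is the variance plus the squared norm of the
    conditional mean. These contribute the coefficients \<open>Q\<^sub>V\<close> and
    \<open>\<zeta>\<^sub>2\<^sup>2\<close>, whose sum is \<open>Q\<^sub>m\<close>.\<close>
  have R_le: "(\<integral>\<omega>. R k \<omega> \<partial>M) \<le> Q + Q\<^sub>m * (\<integral>\<omega>. (norm (G k \<omega>))\<^sup>2 \<partial>M)" if k: "1 \<le> k" for k
  proof -
    note ce = sigma_finite_subalgebra.real_cond_exp_int[OF subalgM R_int[OF k], of k]
    have "AE \<omega> in M. real_cond_exp M (F k) (R k) \<omega> \<le> Q + Q\<^sub>m * (norm (G k \<omega>))\<^sup>2"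
      using second[OF k] variance[OF k]
    proof eventually_elim
      case (elim \<omega>)
      have "(norm (vec_cond_exp M (F k) (J k) \<omega>))\<^sup>2 \<le> (\<zeta>\<^sub>2 * norm (G k \<omega>))\<^sup>2"
        using elim(1) unfolding G_def by (rule power_mono) simp
      with elim(2) show ?case
        by (simp add: R_def[abs_def] G_def Qm algebra_simps power_mult_distrib)
    qed
    then have "(\<integral>\<omega>. real_cond_exp M (F k) (R k) \<omega> \<partial>M) \<le> (\<integral>\<omega>. Q + Q\<^sub>m * (norm (G k \<omega>))\<^sup>2 \<partial>M)"
      using ce(1) G2'[OF k] by (intro integral_mono_AE) auto
    then show ?thesis using ce(2) G2'[OF k] by (simp add: prob_space)
  qed

  have expected: "(\<integral>\<omega>. V (x (Suc k) \<omega>) \<partial>M)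
      \<le> (\<integral>\<omega>. V (x k \<omega>) \<partial>M) - \<alpha> * \<zeta>\<^sub>1 / 2 * (\<integral>\<omega>. (norm (G k \<omega>))\<^sup>2 \<partial>M) + \<gamma>_hat * \<alpha>\<^sup>2 * Q / 2"
    if k: "1 \<le> k" for k
  proof -
    define d where "d = (\<integral>\<omega>. (norm (G k \<omega>))\<^sup>2 \<partial>M)"
    have d: "0 \<le> d" by (simp add: d_def)
    have "(\<integral>\<omega>. V (x (Suc k) \<omega>) \<partial>M)
        \<le> (\<integral>\<omega>. V (x k \<omega>) - \<alpha> * (G k \<omega> \<bullet> J k \<omega>) + \<gamma>_hat * \<alpha>\<^sup>2 / 2 * R k \<omega> \<partial>M)"
      using descent[OF k] V_int GJ[OF k] R_int[OF k] k by (intro integral_mono) auto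
    also have "\<dots> = (\<integral>\<omega>. V (x k \<omega>) \<partial>M) - \<alpha> * (\<integral>\<omega>. G k \<omega> \<bullet> J k \<omega> \<partial>M)
        + \<gamma>_hat * \<alpha>\<^sup>2 / 2 * (\<integral>\<omega>. R k \<omega> \<partial>M)"
      using V_int[OF k] GJ[OF k] R_int[OF k] by simp
    also have "\<dots> \<le> (\<integral>\<omega>. V (x k \<omega>) \<partial>M) - \<alpha> * (\<zeta>\<^sub>1 * d) + \<gamma>_hat * \<alpha>\<^sup>2 / 2 * (Q + Q\<^sub>m * d)"
      using inner_ge[OF k] R_le[OF k] \<alpha> ghat_nonneg unfolding d_def
      by (intro add_mono diff_mono mult_left_mono) auto
    \<comment> \<open>The terms are regrouped to isolate the factor bounded in \<open>step'\<close>;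
      half of \<open>\<alpha> * \<zeta>\<^sub>1 * d\<close> then survives as decrease.\<close>
    also have "\<dots> = (\<integral>\<omega>. V (x k \<omega>) \<partial>M) - \<alpha> * \<zeta>\<^sub>1 * d + \<gamma>_hat * \<alpha>\<^sup>2 * Q / 2
        + \<alpha> / 2 * d * (\<gamma>_hat * \<alpha> * Q\<^sub>m)"
      by (simp add: field_simps power2_eq_square)
    also have "\<dots> \<le> (\<integral>\<omega>. V (x k \<omega>) \<partial>M) - \<alpha> * \<zeta>\<^sub>1 * d + \<gamma>_hat * \<alpha>\<^sup>2 * Q / 2 + \<alpha> / 2 * d * \<zeta>\<^sub>1"
      using step' \<alpha> d by (intro add_left_mono mult_left_mono) auto
    finally show ?thesis by (simp add: d_def[symmetric] field_simps)
  qed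

  \<comment> \<open>Telescoping and the final bound\<close>
  have telescoped: "(\<integral>\<omega>. V (x (Suc n) \<omega>) \<partial>M)
      \<le> V x1 - \<alpha> * \<zeta>\<^sub>1 / 2 * (\<Sum>k=1..n. \<integral>\<omega>. (norm (G k \<omega>))\<^sup>2 \<partial>M) + real n * (\<gamma>_hat * \<alpha>\<^sup>2 * Q / 2)" for n
  proof (induction n)
    case 0
    \<comment> \<open>For \<open>n = 0\<close> the sum is empty and \<open>Suc 0\<close> is the
      index of the deterministic starting point.\<close>
    have "(\<integral>\<omega>. V (x 1 \<omega>) \<partial>M) = (\<integral>\<omega>. V x1 \<partial>M)"
      using iter unfolding cdsgd_iterates_def by (intro Bochner_Integration.integral_cong) auto
    then show ?case by (simp add: prob_space)
  next
    case (Suc n)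
    with expected[of "Suc n"] show ?case by (simp add: algebra_simps add_divide_distrib)
  qed

  \<comment> \<open>After \<open>m\<close> steps the remaining term is the expectation of
    \<open>V\<close> at iterate \<open>Suc m\<close>, bounded below because the iterates almost
    surely stay in \<open>S\<close>.\<close>
  have "(\<integral>\<omega>. V_inf \<partial>M) \<le> (\<integral>\<omega>. V (x (Suc m) \<omega>) \<partial>M)"
  proof (rule integral_mono_AE)
    show "AE \<omega> in M. V_inf \<le> V (x (Suc m) \<omega>)"
      using inS by eventually_elim (simp add: Vinf)
  qed (simp_all add: V_int)
  then have "V_inf \<le> (\<integral>\<omega>. V (x (Suc m) \<omega>) \<partial>M)"
    by (simp add: prob_space)
  moreover define T where "T = (\<integral>\<omega>. (\<Sum>k=1..m. (norm (G k \<omega>))\<^sup>2) \<partial>M)"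
  moreover have "T = (\<Sum>k=1..m. \<integral>\<omega>. (norm (G k \<omega>))\<^sup>2 \<partial>M)"
    unfolding T_def by (intro Bochner_Integration.integral_sum G2') simp
  ultimately have "\<alpha> * \<zeta>\<^sub>1 / 2 * T \<le> V x1 - V_inf + real m * (\<gamma>_hat * \<alpha>\<^sup>2 * Q / 2)"
    using telescoped[of m] by simp
  \<comment> \<open>Division by \<open>\<alpha> * \<zeta>\<^sub>1 / 2\<close> produces the factor 2
    and lowers \<open>\<alpha>\<^sup>2\<close> to \<open>\<alpha>\<close> in the noise term.\<close>
  then have "T \<le> (V x1 - V_inf + real m * (\<gamma>_hat * \<alpha>\<^sup>2 * Q / 2)) / (\<alpha> * \<zeta>\<^sub>1 / 2)"
    using \<alpha> \<zeta>1 by (simp add: pos_le_divide_eq mult.commute)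
  also have "\<dots> = \<gamma>_hat * real m * \<alpha> * Q / \<zeta>\<^sub>1 + 2 * (V x1 - V_inf) / (\<zeta>\<^sub>1 * \<alpha>)"
    using \<alpha> \<zeta>1 by (simp add: field_simps power2_eq_square)
  finally have "T \<le> \<gamma>_hat * real m * \<alpha> * Q / \<zeta>\<^sub>1 + 2 * (V x1 - V_inf) / (\<zeta>\<^sub>1 * \<alpha>)" .
  moreover have "\<gamma>_hat * real m * \<alpha> * Q = (\<gamma>\<^sub>m * \<alpha> + 1 - lambda_N) * real m * Q"
    unfolding ghat_\<alpha>[symmetric] by simp
  ultimately show ?thesis
    unfolding T_def G_def by (metis (no_types))
qed

end
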